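(* The uniformity relation $\sim$ on listings is an equivalence relation, and the uniformity relation $\sim$ on r.e. subsets of $\mathbb{N}$ is an equivalence relation.
   Context: $\mathbb{N}=\{1,2,3,\dots\}$. A listing of an r.e. set $A\subseteq\mathbb{N}$ is a bijective computable function onto $A$: if $A$ is infinite it is a total computable bijection $h:\mathbb{N}\to A$; if $A$ is finite with $n$ elements it is a bijection $h:\{1,\dots,n\}\to A$. Two listings $h,g$ (of sets of equal cardinality, so with the same domain) are uniform, written $h\sim g$, if $h(i)<h(j)\Leftrightarrow g(i)<g(j)$ for all $i,j$ in their common domain. Two r.e. sets $A,B\subseteq\mathbb{N}$ of equal cardinality are uniform, written $A\sim B$, if there exist a listing $h$ of $A$ and a listing $g$ of $B$ with $h\sim g$ (sets of different cardinality are not uniform). *)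

theory Defs
  imports Main "HOL-Library.Equipollence"
begin

text \<open>
  Partial recursive functions, presented by programs. Programs carry no arity: a program applied
  to an argument list that does not fit is undefined there (\<^term>\<open>None\<close>), or ignores
  surplus arguments in the case of the constant zero. Once the number of inputs is fixed, the
  number of arguments of each subprogram is fixed as well, so the unary partial functions computed
  are exactly the usual unary partial recursive functions.
\<close>

datatype recf =
    Zero
  | Succ
  | Proj nat
  | Comp recf "recf list"
  | PrimRec recf recf
  | Mu recf

text \<open>
  Arguments of projections are counted from 0. The recursion variable of \<^term>\<open>PrimRec f g\<close>
  and the search variable of \<^term>\<open>Mu f\<close> come first in the argument list. Evaluation is strict:
  a composition is undefined if one of the inner values is, and an unbounded search is undefined if
  an undefined value precedes the first zero.
\<close>

primrec run :: "recf \<Rightarrow> nat list \<Rightarrow> nat option" where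
  "run Zero = (\<lambda>xs. Some 0)"
| "run Succ = (\<lambda>xs. case xs of [x] \<Rightarrow> Some (Suc x) | _ \<Rightarrow> None)"
| "run (Proj i) = (\<lambda>xs. if i < length xs then Some (xs ! i) else None)"
| "run (Comp f gs) = (\<lambda>xs.
     let ys = map (\<lambda>g. run g xs) gs
     in if None \<in> set ys then None else run f (map the ys))"
| "run (PrimRec f g) = (\<lambda>xs. case xs of
       [] \<Rightarrow> None
     | n # ys \<Rightarrow> rec_nat (run f ys) (\<lambda>m r. Option.bind r (\<lambda>v. run g (m # v # ys))) n)"
| "run (Mu f) = (\<lambda>xs.
     if \<exists>n. run f (n # xs) = Some 0 \<and> (\<forall>m<n. run f (m # xs) \<noteq> None)
     then Some (LEAST n. run f (n # xs) = Some 0)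
     else None)"

definition computable :: "(nat \<rightharpoonup> nat) \<Rightarrow> bool" where
  "computable f \<longleftrightarrow> (\<exists>p. \<forall>x. run p [x] = f x)"

text \<open>
  The natural numbers of the development start at 1. A total function on them is a
  partial function on \<^typ>\<open>nat\<close> with domain \<open>{1..}\<close>, that is, undefined at 0 only.
\<close>

definition re_set :: "nat set \<Rightarrow> bool" where
  "re_set A \<longleftrightarrow> A \<subseteq> {1..} \<and> (A = {} \<or> (\<exists>f. computable f \<and> dom f = {1..} \<and> ran f = A))"

text \<open>
  For finite \<open>A\<close> the computability requirement is no restriction, since every partial
  function with finite domain is computable.
\<close>

definition listing_of :: "(nat \<rightharpoonup> nat) \<Rightarrow> nat set \<Rightarrow> bool" where
  "listing_of h A \<longleftrightarrow>
     computable h \<and>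
     dom h = (if finite A then {1..card A} else {1..}) \<and>
     inj_on h (dom h) \<and> ran h = A"

definition listings :: "(nat \<rightharpoonup> nat) set" where
  "listings = {h. \<exists>A. re_set A \<and> listing_of h A}"

definition uniform_listings :: "(nat \<rightharpoonup> nat) \<Rightarrow> (nat \<rightharpoonup> nat) \<Rightarrow> bool" where
  "uniform_listings h g \<longleftrightarrow>
     dom h = dom g \<and>
     (\<forall>i\<in>dom h. \<forall>j\<in>dom h. the (h i) < the (h j) \<longleftrightarrow> the (g i) < the (g j))"

definition uniform_sets :: "nat set \<Rightarrow> nat set \<Rightarrow> bool" where
  "uniform_sets A B \<longleftrightarrow>
     A \<approx> B \<and> (\<exists>h g. listing_of h A \<and> listing_of g B \<and> uniform_listings h g)"

text \<open>Listings have the same domain precisely when the listed sets have the same cardinality.\<close>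

lemma listing_dom_eq_iff:
  assumes "listing_of h A" "listing_of g B"
  shows "dom h = dom g \<longleftrightarrow> A \<approx> B"
proof -
  have eq: "dom k \<approx> C" if "listing_of k C" for k C
  proof -
    have "bij_betw (\<lambda>x. the (k x)) (dom k) C"
      unfolding bij_betw_def
    proof
      show "inj_on (\<lambda>x. the (k x)) (dom k)"
        using that unfolding listing_of_def inj_on_def by (metis domIff option.expand)
      have "(\<lambda>x. the (k x)) ` dom k = ran k"
        by (auto simp: ran_def dom_def image_iff) (metis option.sel)
      then show "(\<lambda>x. the (k x)) ` dom k = C"
        using that by (simp add: listing_of_def)
    qed
    then show ?thesis unfolding eqpoll_def by blast
  qed
  show ?thesis
  proof
    assume "dom h = dom g"
    then show "A \<approx> B"
      using eqpoll_trans[OF eqpoll_sym[OF eq[OF assms(1)]]] eq[OF assms(2)] by simp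
  next
    assume AB: "A \<approx> B"
    have "finite A \<longleftrightarrow> finite B" using AB by (rule eqpoll_finite_iff)
    moreover have "card A = card B"
      using AB unfolding eqpoll_def by (auto intro: bij_betw_same_card)
    ultimately show "dom h = dom g" using assms by (simp add: listing_of_def)
  qed
qed

end

theory Submission
  imports Defs "HOL-Library.Infinite_Set"
begin

text \<open>
  Two points are not purely formal. Reflexivity on sets needs a listing of every r.e. set: from an
  enumeration with repetitions one keeps the values occurring for the first time. For transitivity,
  let \<open>h\<close>, \<open>g\<close> be uniform listings of \<open>A\<close>, \<open>B\<close> and \<open>g'\<close>, \<open>k\<close> uniform listings of \<open>B\<close>, \<open>C\<close>. Then
  \<open>g\<^sup>-\<^sup>1 \<circ> g'\<close> is a computable permutation of the common domain, and \<open>h \<circ> g\<^sup>-\<^sup>1 \<circ> g'\<close> is a listing of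
  \<open>A\<close> uniform with \<open>k\<close>.
\<close>

section \<open>Programs for elementary arithmetic\<close>

definition p_one :: recf where "p_one = Comp Succ [Zero]"
definition p_pred :: recf where "p_pred = PrimRec Zero (Proj 0)"
definition p_add :: recf where "p_add = PrimRec (Proj 0) (Comp Succ [Proj 1])"
definition p_mult :: recf where "p_mult = PrimRec Zero (Comp p_add [Proj 1, Proj 2])"

text \<open>The first argument is subtracted from the second, since recursion is on the first.\<close>

definition p_sub :: recf where "p_sub = PrimRec (Proj 0) (Comp p_pred [Proj 1])"

text \<open>Adding both truncated differences gives a value that vanishes exactly when the arguments
  agree, so \<open>Mu\<close> can search for equality.\<close>

definition p_dist :: recf where
  "p_dist = Comp p_add [Comp p_sub [Proj 0, Proj 1], Comp p_sub [Proj 1, Proj 0]]"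

definition p_not :: recf where "p_not = Comp p_sub [Proj 0, p_one]"

abbreviation nat_dist :: "nat \<Rightarrow> nat \<Rightarrow> nat" where
  "nat_dist m n \<equiv> (n - m) + (m - n)"

lemma run_one [simp]: "run p_one xs = Some 1"
  by (simp add: p_one_def)

lemma run_pred [simp]: "run p_pred [n] = Some (n - 1)"
  by (induction n) (auto simp: p_pred_def split: nat.splits)

lemma run_add [simp]: "run p_add [m, n] = Some (m + n)"
  by (induction m) (simp_all add: p_add_def)

lemma run_mult [simp]: "run p_mult [m, n] = Some (m * n)"
  by (induction m) (simp_all add: p_mult_def)

lemma run_sub [simp]: "run p_sub [m, n] = Some (n - m)"
  by (induction m) (simp_all add: p_sub_def)

lemma run_dist [simp]: "run p_dist [m, n] = Some (nat_dist m n)"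
  by (simp add: p_dist_def)

lemma run_not [simp]: "run p_not [n] = Some (1 - n)"
  by (simp add: p_not_def)

lemma Least_eq [simp]: "(LEAST x. x = a) = (a::'a::order)"
  by (rule Least_equality) auto

text \<open>When the searched program is total in its search variable, no undefined value can block
  the search.\<close>

lemma run_Mu_total:
  assumes "\<And>n. run f (n # xs) = Some (t n)" and "\<exists>n. t n = 0"
  shows "run (Mu f) xs = Some (LEAST n. t n = 0)"
  using assms by simp

section \<open>Closure properties of computable partial functions\<close>

lemma computable_comp:
  assumes "computable f" "computable g"
  shows "computable (f \<circ>\<^sub>m g)"
proof -
  obtain p q where "\<And>x. run p [x] = f x" "\<And>x. run q [x] = g x"
    using assms unfolding computable_def by blast
  then have "run (Comp p [q]) [x] = (f \<circ>\<^sub>m g) x" for x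
    by (cases "g x") (simp_all add: map_comp_def)
  then show ?thesis
    unfolding computable_def by blast
qed

text \<open>
  The conditional must not evaluate \<^term>\<open>f\<close> at \<^term>\<open>a\<close>: the recursion below runs its step
  \<open>0\<close> times there, and once otherwise.
\<close>

lemma computable_upd:
  assumes "computable f"
  shows "computable (f(a \<mapsto> b))"
proof -
  obtain p where p: "\<And>x. run p [x] = f x"
    using assms unfolding computable_def by blast
  define const where "const c = ((\<lambda>q. Comp Succ [q]) ^^ c) Zero" for c :: nat
  have const: "run (const c) xs = Some c" for c xs
    by (induction c) (simp_all add: const_def)
  \<comment> \<open>Applying \<open>p_not\<close> twice yields the sign of the distance to
    \<open>a\<close>, which serves as the recursion count.\<close>
  define q where "q = Comp (PrimRec (const b) (Comp p [Proj 2]))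
    [Comp p_not [Comp p_not [Comp p_dist [const a, Proj 0]]], Proj 0]"
  have "run q [x] = (f(a \<mapsto> b)) x" for x
  proof (cases "x = a")
    case True
    then show ?thesis by (simp add: q_def const)
  next
    case False
    then have "1 - (1 - nat_dist a x) = Suc 0" by simp
    with False show ?thesis by (cases "f x") (simp_all add: q_def const p)
  qed
  then show ?thesis
    unfolding computable_def by blast
qed

lemma computable_finite_dom:
  assumes "finite (dom f)"
  shows "computable f"
  using assms
proof (induction "dom f" arbitrary: f rule: finite_induct)
  case empty
  then have "f = Map.empty" by auto
  \<comment> \<open>Position 1 does not exist in a one-element list, so this program is nowhere
    defined.\<close>
  moreover have "run (Proj 1) [x] = None" for x by simp
  ultimately show ?case unfolding computable_def by metis
next
  case (insert a D)
  then have "dom (f(a := None)) = D" by auto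
  with insert have "computable (f(a := None))" by blast
  moreover obtain b where "f a = Some b" using insert by auto
  then have "f = (f(a := None))(a \<mapsto> b)" by auto
  ultimately show ?case by (metis computable_upd)
qed

text \<open>The index of \<open>y\<close> is found by unbounded search. As the domain is an initial
  segment of the positive integers, all values tested before the hit are defined; injectivity makes
  the hit unique.\<close>

lemma computable_inverse:
  assumes h: "computable h" "dom h = {1..n} \<or> dom h = {1..}" and inj: "inj_on h (dom h)"
  obtains k where "computable k" "\<And>i y. h i = Some y \<Longrightarrow> k y = Some i"
proof -
  obtain p where p: "\<And>x. run p [x] = h x"
    using h unfolding computable_def by blast
  \<comment> \<open>Searches start at 0, where \<open>h\<close> is undefined and would block them.
    Hence \<open>e\<close> tests \<open>Suc i\<close>, and \<open>q\<close> adds the 1 back.\<close>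
  define e where "e = Comp p_dist [Comp p [Comp Succ [Proj 0]], Proj 1]"
  have e: "run e [i, y] = map_option (\<lambda>v. nat_dist v y) (h (Suc i))" for i y
    by (cases "h (Suc i)") (simp_all add: e_def p)
  define q where "q = Comp Succ [Mu e]"
  have "run q [y] = Some i" if y: "h i = Some y" for i y
  proof -
    from y h(2) obtain j where i: "i = Suc j"
      by (metis atLeastAtMost_iff atLeast_iff domI not0_implies_Suc not_one_le_zero)
    have zero: "run e [l, y] = Some 0 \<longleftrightarrow> l = j" for l
    proof
      assume "run e [l, y] = Some 0"
      then have "h (Suc l) = Some y" by (auto simp: e)
      with y inj have "Suc l = i" by (metis domI inj_onD)
      then show "l = j" using i by simp
    qed (use y i e in simp)
    have "i \<in> dom h" using y by blast
    then have "run e [l, y] \<noteq> None" if "l < j" for l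
    proof -
      have "Suc l \<in> dom h" using h(2) that \<open>i \<in> dom h\<close> i by (elim disjE) simp_all
      then obtain v where "h (Suc l) = Some v" by blast
      then show ?thesis by (simp add: e)
    qed
    then have "run (Mu e) [y] = Some j"
      by (simp add: zero)
    then show ?thesis by (simp add: q_def i)
  qed
  then show ?thesis
    by (intro that[of "\<lambda>y. run q [y]"]) (auto simp: computable_def)
qed

section \<open>Existence of listings\<close>

lemma listing_of_bij:
  assumes "bij_betw b D A" "D = (if finite A then {1..card A} else {1..})"
    and "computable (\<lambda>x. if x \<in> D then Some (b x) else None)"
  shows "listing_of (\<lambda>x. if x \<in> D then Some (b x) else None) A"
proof -
  have "dom (\<lambda>x. if x \<in> D then Some (b x) else None) = D"
    by (auto split: if_splits)
  moreover have "ran (\<lambda>x. if x \<in> D then Some (b x) else None) = A"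
    using assms(1) by (auto simp: ran_def bij_betw_def split: if_splits)
  moreover have "inj_on (\<lambda>x. if x \<in> D then Some (b x) else None) D"
    using assms(1) by (auto simp: bij_betw_def inj_on_def)
  ultimately show ?thesis
    using assms(2,3) unfolding listing_of_def by simp
qed

lemma finite_set_has_listing:
  assumes "finite A"
  shows "\<exists>h. listing_of h A"
proof -
  obtain b where b: "bij_betw b {1..card A} A"
    using ex_bij_betw_nat_finite_1[OF assms] by blast
  have "computable (\<lambda>x. if x \<in> {1..card A} then Some (b x) else None)"
    by (rule computable_finite_dom) (rule finite_subset[of _ "{1..card A}"], auto split: if_splits)
  then show ?thesis
    using listing_of_bij[OF b] assms by auto
qed

definition first_occs :: "(nat \<Rightarrow> 'a) \<Rightarrow> nat set" where
  "first_occs F = {n. \<forall>m<n. F m \<noteq> F n}"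

text \<open>Each value in the range is attained at a least argument, and this is its only first
  occurrence.\<close>

lemma bij_betw_first_occs: "bij_betw F (first_occs F) (range F)"
  unfolding bij_betw_def
proof
  show "inj_on F (first_occs F)"
    unfolding inj_on_def first_occs_def by (metis (mono_tags, lifting) mem_Collect_eq nat_neq_iff)
  have "\<exists>m \<in> first_occs F. F n = F m" for n
  proof
    show "F n = F (LEAST m. F m = F n)"
      by (metis (mono_tags, lifting) LeastI)
    then show "(LEAST m. F m = F n) \<in> first_occs F"
      unfolding first_occs_def using not_less_Least by auto
  qed
  then show "F ` first_occs F = range F" by blast
qed

text \<open>The set \<open>S\<close> of first occurrences is infinite and decidable, so its
  increasing enumeration is computable by repeatedly searching for the next element.\<close>

lemma infinite_re_set_has_listing:
  assumes "re_set A" "infinite A"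
  shows "\<exists>h. listing_of h A"
proof -
  obtain f where f: "computable f" "dom f = {1..}" "ran f = A"
    using assms unfolding re_set_def by auto
  obtain p where p: "\<And>x. run p [x] = f x"
    using f unfolding computable_def by blast
  define F where "F n = the (f (Suc n))" for n
  have fF: "f (Suc n) = Some (F n)" for n
  proof -
    have "Suc n \<in> dom f" using f by simp
    then show ?thesis unfolding F_def by auto
  qed
  have "range F = A"
  proof -
    have "y \<in> range F" if "f x = Some y" for x y
    proof -
      have "x \<noteq> 0" using that f(2) by (metis atLeast_iff domI not_one_le_zero)
      then obtain n where "x = Suc n" using not0_implies_Suc by blast
      then show ?thesis using that fF[of n] by auto
    qed
    then show ?thesis using f(3) fF by (auto simp: ran_def)
  qed
  define S where "S = first_occs F"
  have bijF: "bij_betw F S A"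
    unfolding S_def using bij_betw_first_occs[of F] \<open>range F = A\<close> by simp
  have infS: "infinite S"
    using bij_betw_finite[OF bijF] assms(2) by simp

  define pF where "pF = Comp p [Comp Succ [Proj 0]]"
  have pF [simp]: "run pF [n] = Some (F n)" for n
    by (simp add: pF_def p fF)
  \<comment> \<open>Membership in \<open>S\<close> as arithmetic: the product over
    \<open>i < n\<close> has a zero factor exactly when \<open>F n\<close> occurred earlier.\<close>
  define pprod where
    "pprod = PrimRec p_one (Comp p_mult [Proj 1, Comp p_dist [Comp pF [Proj 0], Comp pF [Proj 2]]])"
  have pprod [simp]: "run pprod [m, n] = Some (\<Prod>i<m. nat_dist (F i) (F n))" for m n
    by (induction m) (simp_all add: pprod_def)
  have prod_zero: "(\<Prod>i<n. nat_dist (F i) (F n)) \<noteq> 0 \<longleftrightarrow> n \<in> S" for n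
  proof -
    have "nat_dist a c = 0 \<longleftrightarrow> a = c" for a c :: nat by auto
    then show ?thesis
      by (simp only: prod_zero_iff finite_lessThan S_def first_occs_def) blast
  qed
  \<comment> \<open>\<open>Mu\<close> looks for zeros, so the product, multiplied by
    \<open>k - a\<close> to force \<open>k > a\<close>, is negated.\<close>
  define pnext where
    "pnext = Comp p_not [Comp p_mult [Comp p_sub [Proj 1, Proj 0], Comp pprod [Proj 0, Proj 0]]]"
  have pnext: "run pnext [k, a] = Some (1 - (k - a) * (\<Prod>i<k. nat_dist (F i) (F k)))" for k a
    by (simp add: pnext_def)
  have next_zero: "1 - (k - a) * (\<Prod>i<k. nat_dist (F i) (F k)) = 0 \<longleftrightarrow> k \<in> S \<and> a < k" for k a
  proof -
    have "1 - (k - a) * c = 0 \<longleftrightarrow> c \<noteq> 0 \<and> a < k" for c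
      by (auto simp: not_le Suc_le_eq)
    then show ?thesis using prod_zero by metis
  qed
  have mu_next: "run (Mu pnext) [a] = Some (LEAST k. k \<in> S \<and> a < k)" for a
  proof -
    have "\<exists>k. k \<in> S \<and> a < k" using infS by (metis infinite_nat_iff_unbounded)
    then show ?thesis
      using run_Mu_total[of pnext "[a]", OF pnext] unfolding next_zero by blast
  qed
  \<comment> \<open>\<open>Zero\<close> is the correct start: 0 has no predecessors, hence is the
    least element of \<open>S\<close>.\<close>
  define pidx where "pidx = PrimRec Zero (Comp (Mu pnext) [Proj 1])"
  have pidx: "run pidx [n] = Some (enumerate S n)" for n
  proof (induction n)
    case 0
    have "0 \<in> S" by (simp add: S_def first_occs_def)
    then show ?case by (simp add: pidx_def enumerate_0 Least_eq_0)
  next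
    case (Suc n)
    then show ?case
      using mu_next by (simp add: pidx_def enumerate_Suc''[OF infS] del: run.simps(6))
  qed
  text \<open>Predecessor, undefined at \<open>0\<close>.\<close>
  define ppre where "ppre = Mu (Comp p_dist [Comp Succ [Proj 0], Proj 1])"
  have ppre0: "run ppre [0] = None"
    by (simp add: ppre_def)
  have ppreS: "run ppre [Suc n] = Some n" for n
  proof -
    have "nat_dist (Suc m) (Suc n) = 0 \<longleftrightarrow> m = n" for m by auto
    then show ?thesis
      using run_Mu_total[of "Comp p_dist [Comp Succ [Proj 0], Proj 1]" "[Suc n]"
        "\<lambda>m. nat_dist (Suc m) (Suc n)"] by (simp add: ppre_def del: run.simps(6))
  qed
  define b where "b x = F (enumerate S (x - 1))" for x
  \<comment> \<open>Strict composition passes the undefinedness of \<open>ppre\<close> at 0 on to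
    the whole program; the total \<open>p_pred\<close> would give a value there.\<close>
  have "run (Comp pF [Comp pidx [ppre]]) [x] = (if x \<in> {1..} then Some (b x) else None)" for x
    by (cases x) (simp_all add: ppre0 ppreS pidx b_def)
  then have comp: "computable (\<lambda>x. if x \<in> {1..} then Some (b x) else None)"
    unfolding computable_def by blast
  have "bij_betw (\<lambda>x::nat. x - 1) {1..} UNIV"
    by (rule bij_betw_byWitness[where f' = Suc]) auto
  then have "bij_betw (F \<circ> (enumerate S \<circ> (\<lambda>x. x - 1))) {1..} A"
    by (intro bij_betw_trans[OF bij_betw_trans[OF _ bij_enumerate[OF infS]] bijF])
  then have "bij_betw b {1..} A"
    by (simp add: b_def[abs_def] comp_def)
  then have "listing_of (\<lambda>x. if x \<in> {1..} then Some (b x) else None) A"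
    by (rule listing_of_bij[OF _ _ comp]) (use assms(2) in simp)
  then show ?thesis by blast
qed

section \<open>The equivalence laws\<close>

lemma uniform_listings_refl: "uniform_listings h h"
  by (simp add: uniform_listings_def)

lemma uniform_listings_sym: "uniform_listings h g \<Longrightarrow> uniform_listings g h"
  by (simp add: uniform_listings_def)

lemma uniform_listings_trans:
  "uniform_listings h g \<Longrightarrow> uniform_listings g k \<Longrightarrow> uniform_listings h k"
  by (simp add: uniform_listings_def)

lemma uniform_sets_refl: "re_set A \<Longrightarrow> uniform_sets A A"
  using finite_set_has_listing infinite_re_set_has_listing uniform_listings_refl
  unfolding uniform_sets_def by (metis eqpoll_refl)

lemma uniform_sets_sym: "uniform_sets A B \<Longrightarrow> uniform_sets B A"
  unfolding uniform_sets_def by (meson eqpoll_sym uniform_listings_sym)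

text \<open>Two uniformity witnesses may list the shared set \<open>B\<close> in different orders.
  Replacing \<open>g\<close> by \<open>g'\<close> lets them be chained.\<close>

lemma listing_reindex:
  assumes g: "listing_of g B" "listing_of g' B" and h: "listing_of h A" "dom h = dom g"
    and ug: "uniform_listings h g"
  shows "\<exists>h'. listing_of h' A \<and> uniform_listings h' g'"
proof -
  have g1: "computable g" "inj_on g (dom g)" "dom g = {1..card B} \<or> dom g = {1..}" "ran g = B"
    using g(1) unfolding listing_of_def by (auto split: if_splits)
  obtain k where k: "computable k" "\<And>i y. g i = Some y \<Longrightarrow> k y = Some i"
    using computable_inverse[OF g1(1,3,2)] by blast
  have domg: "dom g' = dom g" using g unfolding listing_of_def by simp
  define s where "s = k \<circ>\<^sub>m g'"
  have s: "\<exists>j. s i = Some j \<and> g j = g' i" if i: "i \<in> dom g'" for i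
  proof -
    obtain y where y: "g' i = Some y" using i by blast
    then have "y \<in> ran g" using g g1(4) unfolding listing_of_def by (metis ranI)
    then obtain j where "g j = Some y" unfolding ran_def by blast
    then show ?thesis using k(2) y by (auto simp: s_def map_comp_def)
  qed
  define h' where "h' = h \<circ>\<^sub>m s"
  have h'_None: "h' i = None" if "i \<notin> dom g'" for i
    using that by (simp add: h'_def s_def domIff)
  \<comment> \<open>The index \<open>j\<close> is \<open>s i\<close>. The domain, injectivity and
    uniformity of \<open>h'\<close> all follow from this description.\<close>
  have h's: "\<exists>j \<in> dom h. h' i = h j \<and> g j = g' i" if "i \<in> dom g'" for i
    using s[OF that] h(2) that by (fastforce simp: h'_def map_comp_def)
  have dom: "dom h' = dom g'"
  proof
    show "dom h' \<subseteq> dom g'"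
      using h'_None by (metis domIff subsetI)
    show "dom g' \<subseteq> dom h'"
      using h's by (metis domIff subsetI)
  qed
  have "inj_on h' (dom h')"
  proof (rule inj_onI)
    fix i j assume ij: "i \<in> dom h'" "j \<in> dom h'" "h' i = h' j"
    obtain i' j' where "i' \<in> dom h" "h' i = h i'" "g i' = g' i" "j' \<in> dom h" "h' j = h j'" "g j' = g' j"
      using h's ij dom by metis
    \<comment> \<open>Injectivity of \<open>h\<close> gives \<open>i' = j'\<close>, hence
      \<open>g' i = g' j\<close>, and injectivity of \<open>g'\<close> finishes.\<close>
    moreover have "inj_on h (dom h)" "inj_on g' (dom g')"
      using h g unfolding listing_of_def by auto
    ultimately show "i = j" using ij dom by (metis inj_on_def)
  qed
  moreover have "ran h' = A"
  proof
    show "ran h' \<subseteq> A"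
      using h(1) by (auto simp: h'_def map_comp_def listing_of_def ran_def split: option.splits)
    show "A \<subseteq> ran h'"
    proof
      fix a assume "a \<in> A"
      then have "a \<in> ran h" using h(1) unfolding listing_of_def by simp
      then obtain j where j: "h j = Some a" unfolding ran_def by blast
      then obtain y where y: "g j = Some y" using h(2) by blast
      then have "y \<in> ran g'" using g g1(4) unfolding listing_of_def by (metis ranI)
      then obtain i where "g' i = Some y" unfolding ran_def by blast
      then have "h' i = Some a" using j k(2)[OF y] by (simp add: h'_def s_def map_comp_def)
      then show "a \<in> ran h'" by (rule ranI)
    qed
  qed
  moreover have "computable h'"
    unfolding h'_def s_def using h(1) g(2) k(1) by (auto simp: listing_of_def intro: computable_comp)
  ultimately have "listing_of h' A"
    using dom domg h unfolding listing_of_def by simp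
  moreover have "uniform_listings h' g'"
    unfolding uniform_listings_def
  proof (intro conjI ballI)
    fix i j assume "i \<in> dom h'" "j \<in> dom h'"
    then obtain i' j' where "i' \<in> dom h" "h' i = h i'" "g i' = g' i" "j' \<in> dom h" "h' j = h j'" "g j' = g' j"
      using h's dom by metis
    then show "the (h' i) < the (h' j) \<longleftrightarrow> the (g' i) < the (g' j)"
      using ug unfolding uniform_listings_def by metis
  qed (rule dom)
  ultimately show ?thesis by blast
qed

lemma uniform_sets_trans:
  assumes "uniform_sets A B" "uniform_sets B C"
  shows "uniform_sets A C"
proof -
  obtain h g where hg: "listing_of h A" "listing_of g B" "uniform_listings h g"
    using assms(1) unfolding uniform_sets_def by blast
  obtain g' k where gk: "listing_of g' B" "listing_of k C" "uniform_listings g' k"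
    using assms(2) unfolding uniform_sets_def by blast
  have "dom h = dom g" using hg(3) unfolding uniform_listings_def by blast
  then obtain h' where "listing_of h' A" "uniform_listings h' g'"
    using listing_reindex[OF hg(2) gk(1) hg(1) _ hg(3)] by blast
  moreover have "A \<approx> C"
    using assms eqpoll_trans unfolding uniform_sets_def by blast
  ultimately show ?thesis
    using gk uniform_listings_trans unfolding uniform_sets_def by blast
qed

theorem lemma2p4:
  shows "equiv listings {(h, g). h \<in> listings \<and> g \<in> listings \<and> uniform_listings h g} \<and>
         equiv {A. re_set A} {(A, B). re_set A \<and> re_set B \<and> uniform_sets A B}"
proof
  show "equiv listings {(h, g). h \<in> listings \<and> g \<in> listings \<and> uniform_listings h g}"
    by (rule equivI)
      (auto simp: refl_on_def sym_def trans_def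
        intro: uniform_listings_refl uniform_listings_sym uniform_listings_trans)
  show "equiv {A. re_set A} {(A, B). re_set A \<and> re_set B \<and> uniform_sets A B}"
    by (rule equivI)
      (auto simp: refl_on_def sym_def trans_def
        intro: uniform_sets_refl uniform_sets_sym uniform_sets_trans)
qed

end
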